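(* For $n\geq 0$ let $$A_n(r,b)=\sum_{w\in\mathscr{D}_n} r^{C_r(w)}\,b^{C_b(w)},$$ where $C_r(w)$ and $C_b(w)$ are the numbers of red, respectively blue, edges of the Hasse diagram of $(\mathscr{D}_n,\leq)$ arriving at $w$. Then for every $n\geq 1$, $$A_n(r,rb)=r^{n-1}A_n(1/r,b/r).$$
   Context: A Dyck path of size $n\geq 0$ is a word of length $2n$ in the letters $0,1$ with $n$ letters $1$ and $n$ letters $0$ such that every prefix contains at least as many $1$'s as $0$'s (the height after a prefix is its number of $1$'s minus its number of $0$'s). Let $\mathscr{D}_n$ be the set of Dyck paths of size $n$. A subpath of a Dyck path $w$ is a non-empty sequence $x$ of consecutive letters of $w$ that starts and ends at the same height and stays strictly above that height in between. A subpath $x$ is movable in $w$ if it is immediately preceded in $w$ by the letter $0$ and either $x$ ends at the last letter of $w$ or $x$ is immediately followed in $w$ by the letter $1$. For a movable subpath $x$, let $N=N(w,x)\geq 1$ be the number of consecutive letters $0$ just before $x$, so $w=a\,0^{N}\,x\,b$ where $a$ does not end with $0$; for $1\leq i\leq N$ let $M(w,x,i)=a\,0^{N-i}\,x\,0^{i}\,b\in\mathscr{D}_n$. Let $\Gamma_n$ be the directed graph on $\mathscr{D}_n$ with edges $w\to M(w,x,i)$ for all movable $x$ in $w$ and all $1\leq i\leq N(w,x)$. The dexter order is: $u\leq v$ if and only if there is a directed path (possibly of length $0$) from $u$ to $v$ in $\Gamma_n$. This is a partial order whose cover relations are exactly the edges of $\Gamma_n$, so $\Gamma_n$ is its Hasse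 diagram. Coloring: an edge $w\to M(w,x,i)$ is red if the subpath $x$ is slid to its highest possible position, i.e. $i=N(w,x)$; all other edges are blue. The edge $w\to w'$ is said to arrive at (be incoming at) $w'$. *)

theory Defs
  imports Complex_Main
begin

text \<open>Words in the letters 0 and 1 are lists of booleans, \<^term>\<open>True\<close> being the letter 1.\<close>

definition height :: "bool list \<Rightarrow> int" where
  "height w = int (count_list w True) - int (count_list w False)"

definition dyck_paths :: "nat \<Rightarrow> bool list set" where
  "dyck_paths n = {w. length w = 2 * n \<and> count_list w True = n \<and> count_list w False = n \<and>
     (\<forall>k\<le>length w. count_list (take k w) False \<le> count_list (take k w) True)}"

text \<open>Subpaths are occurrences, not just words: \<open>subpath w p x s\<close> says that the factor \<open>x\<close> of
  \<open>w\<close> lying between the prefix \<open>p\<close> and the suffix \<open>s\<close> is a subpath of \<open>w\<close>.\<close>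

definition subpath :: "bool list \<Rightarrow> bool list \<Rightarrow> bool list \<Rightarrow> bool list \<Rightarrow> bool" where
  "subpath w p x s \<longleftrightarrow> w = p @ x @ s \<and> x \<noteq> [] \<and> height (p @ x) = height p \<and>
     (\<forall>k. 0 < k \<and> k < length x \<longrightarrow> height p < height (p @ take k x))"

definition movable :: "bool list \<Rightarrow> bool list \<Rightarrow> bool list \<Rightarrow> bool list \<Rightarrow> bool" where
  "movable w p x s \<longleftrightarrow> subpath w p x s \<and> p \<noteq> [] \<and> last p = False \<and> (s = [] \<or> hd s = True)"

text \<open>\<open>slide w N i w'\<close>: for some movable subpath \<open>x\<close> of \<open>w\<close> we have \<open>N = N(w,x)\<close>,
  \<open>1 \<le> i \<le> N\<close> and \<open>w' = M(w,x,i)\<close>.\<close>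

definition slide :: "bool list \<Rightarrow> nat \<Rightarrow> nat \<Rightarrow> bool list \<Rightarrow> bool" where
  "slide w N i w' \<longleftrightarrow> (\<exists>a x b. movable w (a @ replicate N False) x b \<and>
     (a = [] \<or> last a \<noteq> False) \<and> 1 \<le> i \<and> i \<le> N \<and>
     w' = a @ replicate (N - i) False @ x @ replicate i False @ b)"

definition dexter_edge :: "nat \<Rightarrow> bool list \<Rightarrow> bool list \<Rightarrow> bool" where
  "dexter_edge n u v \<longleftrightarrow> u \<in> dyck_paths n \<and> v \<in> dyck_paths n \<and> (\<exists>N i. slide u N i v)"

definition dexter_le :: "nat \<Rightarrow> bool list \<Rightarrow> bool list \<Rightarrow> bool" where
  "dexter_le n u v \<longleftrightarrow> u \<in> dyck_paths n \<and> v \<in> dyck_paths n \<and> (dexter_edge n)\<^sup>*\<^sup>* u v"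

definition dexter_less :: "nat \<Rightarrow> bool list \<Rightarrow> bool list \<Rightarrow> bool" where
  "dexter_less n u v \<longleftrightarrow> dexter_le n u v \<and> u \<noteq> v"

text \<open>The edges \<open>u \<rightarrow> v\<close> of the Hasse diagram are the cover relations of the dexter order.\<close>

definition hasse_edge :: "nat \<Rightarrow> bool list \<Rightarrow> bool list \<Rightarrow> bool" where
  "hasse_edge n u v \<longleftrightarrow> dexter_less n u v \<and> \<not> (\<exists>z. dexter_less n u z \<and> dexter_less n z v)"

text \<open>The endpoints of an edge determine \<open>x\<close> and \<open>i\<close>, so the colour is a property of the pair
  of endpoints, and edges arriving at \<open>w\<close> may be counted by their sources.\<close>

definition red_edge :: "nat \<Rightarrow> bool list \<Rightarrow> bool list \<Rightarrow> bool" where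
  "red_edge n u v \<longleftrightarrow> hasse_edge n u v \<and> (\<exists>N. slide u N N v)"

definition blue_edge :: "nat \<Rightarrow> bool list \<Rightarrow> bool list \<Rightarrow> bool" where
  "blue_edge n u v \<longleftrightarrow> hasse_edge n u v \<and> \<not> red_edge n u v"

definition C_red :: "nat \<Rightarrow> bool list \<Rightarrow> nat" where
  "C_red n w = card {u. red_edge n u w}"

definition C_blue :: "nat \<Rightarrow> bool list \<Rightarrow> nat" where
  "C_blue n w = card {u. blue_edge n u w}"

definition A :: "nat \<Rightarrow> 'a::comm_semiring_1 \<Rightarrow> 'a \<Rightarrow> 'a" where
  "A n r b = (\<Sum>w\<in>dyck_paths n. r ^ C_red n w * b ^ C_blue n w)"

end

theory Submission
  imports Defs "HOL-Computational_Algebra.Formal_Power_Series"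
begin

text \<open>Record a Dyck path by its area sequence, the heights before its letters 1. A slide adds a constant
  to a block of consecutive entries; it increases the sequence pointwise and preserves the
  descendant relation of the corresponding plane tree. If \<open>u \<rightarrow> v\<close> is an edge, these two monotone
  quantities force every path from \<open>u\<close> to \<open>v\<close> to start with a slide of the same subpath, which then
  cannot be moved again below \<open>v\<close>; hence every edge is a cover.

  In the plane tree of \<open>w\<close>, the red (blue) edges arriving at \<open>w\<close> correspond to the non-root nodes
  with exactly one child (at least two children). Hence the generating function \<open>U\<close> of
  \<open>A n r (r * b)\<close> over \<open>n \<ge> 1\<close> satisfies \<open>U = t (1 + (1 + r) U + r b U\<^sup>2)\<close>. The series obtained from
  \<open>U\<close> by \<open>r \<mapsto> 1 / r\<close>, \<open>t \<mapsto> r t\<close> and division by \<open>r\<close> satisfies the same equation, which has a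
  unique solution.\<close>

section \<open>Area sequences\<close>

fun area :: "int \<Rightarrow> bool list \<Rightarrow> int list" where
  "area c [] = []"
| "area c (True # w) = c # area (c + 1) w"
| "area c (False # w) = area (c - 1) w"

lemma height_Nil [simp]: "height [] = 0"
  and height_True [simp]: "height (True # w) = height w + 1"
  and height_False [simp]: "height (False # w) = height w - 1"
  and height_append [simp]: "height (v @ w) = height v + height w"
  and height_replicate_False [simp]: "height (replicate N False) = - int N"
  by (induction N) (simp_all add: height_def)

lemma area_append: "area c (v @ w) = area c v @ area (c + height v) w"
  by (induction c v rule: area.induct) (auto simp: algebra_simps)

lemma area_shift: "area (c + d) w = map (\<lambda>x. x + d) (area c w)"
  by (induction c w rule: area.induct) (auto simp: algebra_simps)

lemma area_replicate_False [simp]: "area c (replicate N False) = []"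
  by (induction N arbitrary: c) auto

lemma area_eq_Nil: "area c w = [] \<Longrightarrow> w = replicate (length w) False"
  by (induction c w rule: area.induct) auto

lemma length_area: "length (area c w) = count_list w True"
  by (induction c w rule: area.induct) auto

lemma hd_area_le: "area c w \<noteq> [] \<Longrightarrow> hd (area c w) \<le> c"
proof (induction c w rule: area.induct)
  case (3 c w)
  then have "hd (area (c - 1) w) \<le> c - 1" by simp
  then show ?case by simp
qed auto

lemma successively_area: "successively (\<lambda>x y. y \<le> x + 1) (area c w)"
proof (induction c w rule: area.induct)
  case (2 c w)
  then show ?case using hd_area_le[of "c + 1" w] by (cases "area (c + 1) w = []") (auto simp: successively_Cons)
qed auto

lemma in_set_area:
  "y \<in> set (area c w) \<Longrightarrow> \<exists>k<length w. y = c + height (take k w)"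
proof (induction c w rule: area.induct)
  case (2 c w)
  show ?case
  proof (cases "y = c")
    case True
    then show ?thesis by (intro exI[of _ 0]) auto
  next
    case False
    then obtain k where "k < length w" "y = c + 1 + height (take k w)" using 2 by auto
    then show ?thesis by (intro exI[of _ "Suc k"]) auto
  qed
next
  case (3 c w)
  then obtain k where "k < length w" "y = c - 1 + height (take k w)" by auto
  then show ?case by (intro exI[of _ "Suc k"]) auto
qed auto

text \<open>A letter 1 is read at the height of an entry, and a letter 0 is read one above the
  height that follows it, which is at least \<open>m - 1\<close>.\<close>

lemma height_take_ge:
  assumes "\<forall>z\<in>set (area c w). m \<le> z" "m - 1 \<le> c + height w" "k < length w"
  shows "m \<le> c + height (take k w)"
  using assms
proof (induction c w arbitrary: k rule: area.induct)
  case (2 c w)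
  then show ?case by (cases k) (auto simp: algebra_simps)
next
  case (3 c w)
  show ?case
  proof (cases k)
    case 0
    then show ?thesis using 3(1)[of 0] 3(2-) by (cases w) auto
  next
    case (Suc j)
    then show ?thesis using 3(1)[of j] 3(2-) by (auto simp: algebra_simps)
  qed
qed auto

text \<open>The heights before consecutive letters 1 determine the numbers of letters 0 between
  them, and the final height determines the last run of letters 0.\<close>

lemma area_inject:
  assumes "area c v = area c w" "height v = height w"
  shows "v = w"
  using assms
proof (induction c v arbitrary: w rule: area.induct)
  case (1 c)
  then have "w = replicate (length w) False" using area_eq_Nil[of c w] by simp
  then have "height w = - int (length w)" by (metis height_replicate_False)
  then show ?case using 1 by simp
next
  case (2 c v)
  show ?case
  proof (cases w)
    case (Cons x w')
    show ?thesis
    proof (cases x)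
      case False
      then have "area (c - 1) w' = c # area (c + 1) v" using 2 Cons by auto
      then show ?thesis using hd_area_le[of "c - 1" w'] by simp
    qed (use 2 Cons in auto)
  qed (use 2 in auto)
next
  case (3 c v)
  show ?case
  proof (cases w)
    case Nil
    then have "v = replicate (length v) False" using 3 area_eq_Nil[of "c - 1" v] by simp
    then have "height v = - int (length v)" by (metis height_replicate_False)
    then show ?thesis using 3 Nil by simp
  next
    case (Cons x w')
    show ?thesis
    proof (cases x)
      case True
      then have "area (c - 1) v = c # area (c + 1) w'" using 3 Cons by auto
      then show ?thesis using hd_area_le[of "c - 1" v] by simp
    qed (use 3 Cons in auto)
  qed
qed

lemma area_eq_appendD:
  assumes "area c w = h1 @ y # h2"
  shows "\<exists>w1 w2. w = w1 @ True # w2 \<and> area c w1 = h1 \<and> y = c + height w1 \<and> area (y + 1) w2 = h2"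
  using assms
proof (induction c w arbitrary: h1 rule: area.induct)
  case (2 c w)
  show ?case
  proof (cases h1)
    case Nil
    then show ?thesis using 2 by (intro exI[of _ "[]"] exI[of _ w]) auto
  next
    case (Cons z h1')
    then obtain w1 w2 where "w = w1 @ True # w2" "area (c + 1) w1 = h1'"
      "y = c + 1 + height w1" "area (y + 1) w2 = h2" using 2 by fastforce
    then show ?thesis using 2 Cons by (intro exI[of _ "True # w1"] exI[of _ w2]) auto
  qed
next
  case (3 c w)
  then obtain w1 w2 where "w = w1 @ True # w2" "area (c - 1) w1 = h1"
    "y = c - 1 + height w1" "area (y + 1) w2 = h2" by fastforce
  then show ?case by (intro exI[of _ "False # w1"] exI[of _ w2]) auto
qed auto

lemma dyck_paths_iff:
  "w \<in> dyck_paths n \<longleftrightarrow> count_list w True = n \<and> height w = 0 \<and>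
     (\<forall>k\<le>length w. 0 \<le> height (take k w))"
proof -
  have "length w = count_list w True + count_list w False"
    by (induction w) (auto split: bool.splits)
  then show ?thesis by (auto simp: dyck_paths_def height_def)
qed

definition area_seq :: "int \<Rightarrow> int list \<Rightarrow> bool" where
  "area_seq c h \<longleftrightarrow> (\<forall>x\<in>set h. c \<le> x) \<and> (h \<noteq> [] \<longrightarrow> hd h = c) \<and> successively (\<lambda>x y. y \<le> x + 1) h"

lemma area_seq_area:
  assumes "w \<in> dyck_paths n"
  shows "area_seq 0 (area 0 w)"
proof -
  have "0 \<le> x" if "x \<in> set (area 0 w)" for x
    using in_set_area[OF that] assms by (auto simp: dyck_paths_iff)
  moreover have "hd (area 0 w) = 0" if "area 0 w \<noteq> []"
    using hd_area_le[OF that] calculation[of "hd (area 0 w)"] that by auto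
  ultimately show ?thesis by (simp add: area_seq_def successively_area)
qed

section \<open>Dyck paths as trees\<close>

text \<open>\<open>Node y z\<close> stands for the Dyck path \<open>1 y 0 z\<close>.\<close>

datatype dtree = Leaf | Node dtree dtree

fun nodes :: "dtree \<Rightarrow> nat" where
  "nodes Leaf = 0"
| "nodes (Node y z) = Suc (nodes y + nodes z)"

fun word :: "dtree \<Rightarrow> bool list" where
  "word Leaf = []"
| "word (Node y z) = True # word y @ False # word z"

text \<open>With \<open>y\<close> as the children of the first root and \<open>z\<close> as its
  later siblings, a \<open>dtree\<close> is a plane forest; this lists the depths of its nodes in
  preorder, the roots having depth \<open>c\<close>.\<close>

fun tree_area :: "int \<Rightarrow> dtree \<Rightarrow> int list" where
  "tree_area c Leaf = []"
| "tree_area c (Node y z) = c # tree_area (c + 1) y @ tree_area c z"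

lemma height_word [simp]: "height (word t) = 0"
  by (induction t) auto

lemma area_word: "area c (word t) = tree_area c t"
  by (induction t arbitrary: c) (auto simp: area_append)

lemma height_take_word: "0 \<le> height (take k (word t))"
proof (induction t arbitrary: k)
  case (Node y z)
  show ?case
  proof (cases k)
    case (Suc j)
    have "0 \<le> height (take j (word y)) " by (rule Node)
    moreover have "height (take j (word y)) = 0" if "length (word y) \<le> j" using that by simp
    moreover have "0 \<le> height (take l (word z))" for l by (rule Node)
    ultimately show ?thesis using Suc
      by (cases "j - length (word y)") auto
  qed auto
qed auto

lemma count_list_word: "count_list (word t) True = nodes t"
  by (induction t) auto

lemma word_in_dyck_paths: "word t \<in> dyck_paths (nodes t)"
  by (simp add: dyck_paths_iff count_list_word height_take_word)

lemma tree_area_ge: "x \<in> set (tree_area c t) \<Longrightarrow> c \<le> x"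
  by (induction t arbitrary: c) fastforce+

text \<open>After the leading \<open>c\<close>, the longest run of entries above \<open>c\<close> is
  the part below the first root, and the rest starts at \<open>c\<close> again. The step condition
  makes the run start at \<open>c + 1\<close>.\<close>

lemma tree_area_surj: "area_seq c h \<Longrightarrow> \<exists>t. tree_area c t = h"
proof (induction "length h" arbitrary: c h rule: less_induct)
  case less
  show ?case
  proof (cases h)
    case Nil
    then show ?thesis by (intro exI[of _ Leaf]) simp
  next
    case (Cons d r)
    with less.prems have d: "d = c" by (simp add: area_seq_def)
    define y z where "y = takeWhile (\<lambda>x. c < x) r" and "z = dropWhile (\<lambda>x. c < x) r"
    have r: "r = y @ z" by (simp add: y_def z_def)
    have s: "successively (\<lambda>x y. y \<le> x + 1) (c # y @ z)"
      using less.prems Cons d r by (simp add: area_seq_def)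
    have ge: "\<forall>x\<in>set z. c \<le> x" using less.prems Cons r by (simp add: area_seq_def)
    have y: "\<forall>x\<in>set y. c < x" by (auto simp: y_def dest: set_takeWhileD)
    have "hd y = c + 1" if "y \<noteq> []"
    proof -
      have "c < hd y" using y hd_in_set[OF that] by blast
      then show ?thesis using that s by (auto simp: successively_Cons)
    qed
    then have 1: "area_seq (c + 1) y"
      using s y by (auto simp: area_seq_def successively_Cons successively_append_iff)
    have "hd z = c" if "z \<noteq> []"
      using that ge hd_dropWhile[of "\<lambda>x. c < x" r] hd_in_set[OF that] by (fastforce simp: z_def)
    then have 2: "area_seq c z"
      using s ge by (auto simp: area_seq_def successively_Cons successively_append_iff)
    obtain t1 t2 where "tree_area (c + 1) t1 = y" "tree_area c t2 = z"
      using less.hyps[OF _ 1] less.hyps[OF _ 2] Cons r by auto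
    then show ?thesis using Cons d r by (intro exI[of _ "Node t1 t2"]) simp
  qed
qed

lemma dyck_path_is_word:
  assumes "w \<in> dyck_paths n"
  obtains t where "w = word t" "nodes t = n"
proof -
  obtain t where "tree_area 0 t = area 0 w"
    using tree_area_surj[OF area_seq_area[OF assms]] by blast
  then have "word t = w"
    using assms by (intro area_inject[of 0]) (auto simp: area_word dyck_paths_iff)
  then show ?thesis using that assms by (auto simp: dyck_paths_iff count_list_word)
qed

text \<open>The longest run of positive entries after the leading \<open>0\<close> belongs to the
  first subtree, so both subtrees can be read off the area sequence.\<close>

lemma word_inject: "word s = word t \<Longrightarrow> s = t"
proof (induction s arbitrary: t)
  case Leaf
  then show ?case by (cases t) auto
next
  case (Node y z)
  then obtain y' z' where t: "t = Node y' z'" by (cases t) auto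
  have *: "tree_area 1 y @ tree_area 0 z = tree_area 1 y' @ tree_area 0 z'"
    using arg_cong[OF Node.prems, of "area 0"] unfolding t area_word by simp
  have tw: "takeWhile (\<lambda>x. 0 < x) (tree_area 1 u @ tree_area 0 v) = tree_area 1 u" for u v
  proof -
    have "takeWhile (\<lambda>x. 0 < x) (tree_area 0 v) = []"
      by (cases v) auto
    moreover have "\<forall>x\<in>set (tree_area 1 u). 0 < x" using tree_area_ge[of _ 1 u] by force
    ultimately show ?thesis by simp
  qed
  have "tree_area 1 y = tree_area 1 y'" using tw[of y z] tw[of y' z'] * by simp
  moreover from this have "tree_area 0 z = tree_area 0 z'" using * by simp
  ultimately have "word y = word y'" "word z = word z'"
    by (auto intro: area_inject[of 1] area_inject[of 0] simp: area_word)
  then show ?case using Node.IH t by auto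
qed

section \<open>Slides of area sequences\<close>

text \<open>A final height \<open>0\<close> is appended to area sequences, so that a subpath ending the path is not
  exceptional.\<close>

definition raise :: "int list \<Rightarrow> nat \<Rightarrow> nat \<Rightarrow> int list \<Rightarrow> int list \<Rightarrow> int \<Rightarrow> int list \<Rightarrow> int list \<Rightarrow> bool" where
  "raise h N i h' al c xi be \<longleftrightarrow> h = al @ (c # xi) @ be \<and> h' = al @ map (\<lambda>x. x + int i) (c # xi) @ be \<and>
     al \<noteq> [] \<and> int N = last al + 1 - c \<and> 1 \<le> i \<and> i \<le> N \<and> (\<forall>x\<in>set xi. c < x) \<and> c = hd (be @ [0])"

text \<open>\<open>al\<close> comes from \<open>a\<close>, which ends with 1, \<open>c # xi\<close>
  from \<open>x\<close> and \<open>be\<close> from \<open>b\<close>. After its last 1,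
  \<open>a\<close> is at height \<open>last al + 1\<close>, and the \<open>N\<close> letters 0 lead
  from there down to \<open>c\<close>.\<close>

lemma slide_imp_raise:
  assumes u: "u \<in> dyck_paths n" and "slide u N i v"
  shows "\<exists>al c xi be. raise (area 0 u) N i (area 0 v) al c xi be"
proof -
  obtain a x b where m: "movable u (a @ replicate N False) x b" and a: "a = [] \<or> last a \<noteq> False"
    and i: "1 \<le> i" "i \<le> N" and v: "v = a @ replicate (N - i) False @ x @ replicate i False @ b"
    using assms(2) unfolding slide_def by blast
  have w: "u = a @ replicate N False @ x @ b" and x: "x \<noteq> []" "height x = 0"
    and up: "\<And>k. 0 < k \<Longrightarrow> k < length x \<Longrightarrow> 0 < height (take k x)"
    and b: "b = [] \<or> hd b"
    using m by (auto simp: movable_def subpath_def)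
  have "a \<noteq> []"
  proof
    assume "a = []"
    then have "u = False # replicate (N - 1) False @ x @ b" using w i by (cases N) auto
    then have "height (take 1 u) = -1" "1 \<le> length u" by auto
    then show False using u by (fastforce simp: dyck_paths_iff)
  qed
  then obtain a' where a': "a = a' @ [True]" using a by (metis append_butlast_last_id)
  obtain y where y: "x = True # y"
  proof (cases x)
    case (Cons l y)
    have "y \<noteq> []" using Cons x by (cases l) auto
    then have "l" using up[of 1] Cons by (cases l) auto
    then show ?thesis using that Cons by simp
  qed (use x in auto)
  define c where "c = height a - int N"
  have above: "\<forall>z\<in>set (area (c + 1) y). c < z"
  proof
    fix z assume "z \<in> set (area (c + 1) y)"
    then obtain k where "k < length y" "z = c + 1 + height (take k y)" using in_set_area by blast
    then show "c < z" using up[of "Suc k"] y by auto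
  qed
  have "height u = 0" using u by (simp add: dyck_paths_iff)
  then have "b = [] \<Longrightarrow> c = 0" using w x by (simp add: c_def)
  then have hd: "c = hd (area c b @ [0])" using b by (cases b) auto
  have v': "area 0 v = area 0 a @ map (\<lambda>x. x + int i) (c # area (c + 1) y) @ area c b"
  proof -
    have "0 + height a - int (N - i) = c + int i" using i by (simp add: c_def of_nat_diff)
    moreover have "height y = -1" using x y by simp
    ultimately show ?thesis using area_shift[of c "int i" x] by (simp add: v area_append y)
  qed
  have u': "area 0 u = area 0 a @ (c # area (c + 1) y) @ area c b"
  proof -
    have "height y = -1" using x y by simp
    then show ?thesis using y x by (simp add: w area_append c_def)
  qed
  have "raise (area 0 u) N i (area 0 v) (area 0 a) c (area (c + 1) y) (area c b)"
    unfolding raise_def using u' v' i above hd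
    by (simp add: a' area_append c_def)
  then show ?thesis by blast
qed

text \<open>The word \<open>u\<close> is cut at the letters 1 of the entries \<open>last al\<close>
  and \<open>c\<close>; no entry lies between them, so only letters 0 do. The slid word has the area
  sequence of \<open>v\<close>, hence equals \<open>v\<close>.\<close>

lemma raise_imp_slide:
  assumes u: "u \<in> dyck_paths n" and v: "v \<in> dyck_paths n"
    and "raise (area 0 u) N i (area 0 v) al c xi be"
  shows "slide u N i v"
proof -
  have hu: "area 0 u = al @ (c # xi) @ be" and hv: "area 0 v = al @ map (\<lambda>x. x + int i) (c # xi) @ be"
    and al: "al \<noteq> []" "int N = last al + 1 - c" and i: "1 \<le> i" "i \<le> N"
    and xi: "\<forall>x\<in>set xi. c < x" and c: "c = hd (be @ [0])"
    using assms(3) unfolding raise_def by blast+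
  have hz: "height u = 0" "height v = 0" using u v by (auto simp: dyck_paths_iff)
  obtain al' l where al': "al = al' @ [l]" using al(1) by (metis append_butlast_last_id)
  obtain a1 w2 where w2: "u = a1 @ True # w2" "l = height a1" "area 0 a1 = al'"
    "area (l + 1) w2 = c # xi @ be"
  proof -
    have "area 0 u = al' @ l # (c # xi @ be)" by (simp add: hu al')
    from area_eq_appendD[OF this] show ?thesis using that by fastforce
  qed
  obtain w3 w4 where w4: "w2 = w3 @ True # w4" "area (l + 1) w3 = []" "c = l + 1 + height w3"
    "area (c + 1) w4 = xi @ be"
  proof -
    have "area (l + 1) w2 = [] @ c # (xi @ be)" by (simp add: w2(4))
    from area_eq_appendD[OF this] show ?thesis using that by blast
  qed
  obtain K where K: "w3 = replicate K False" using area_eq_Nil w4(2) by blast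
  have KN: "K = N" using w4(3) al(2) al' by (simp add: K)
  \<comment> \<open>The subpath ends before the 1 of the first entry of \<open>be\<close>, which is
    again at height \<open>c\<close>; if \<open>be\<close> is empty, it takes up the rest of the
    word.\<close>
  have "\<exists>y b. w4 = y @ b \<and> height y = -1 \<and> area (c + 1) y = xi \<and> area c b = be \<and> (b = [] \<or> hd b = True)"
  proof (cases be)
    case Nil
    then have "c = 0" using c by simp
    moreover have "height w4 = - 1 - c" using hz(1) unfolding w2(1) w4(1) w4(3) w2(2) by simp
    ultimately have "height w4 = - 1" by simp
    then show ?thesis using w4(4) Nil by (intro exI[of _ w4] exI[of _ "[]"]) simp
  next
    case (Cons d be')
    have "area (c + 1) w4 = xi @ d # be'" by (simp add: w4(4) Cons)
    from area_eq_appendD[OF this] obtain y z where y: "w4 = y @ True # z" "area (c + 1) y = xi"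
      "d = c + 1 + height y" "area (d + 1) z = be'" by blast
    have d: "d = c" using c Cons by simp
    then have "height y = -1" using y(3) by linarith
    moreover have "area c (True # z) = be" using y(4) d Cons by simp
    ultimately show ?thesis using y(1,2) by (intro exI[of _ y] exI[of _ "True # z"]) simp
  qed
  then obtain y b where y: "w4 = y @ b" "height y = -1" "area (c + 1) y = xi" "area c b = be" "b = [] \<or> hd b = True"
    by blast
  define a x where "a = a1 @ [True]" and "x = True # y"
  have wu: "u = a @ replicate N False @ x @ b" by (simp add: w2(1) w4(1) y(1) a_def x_def K KN)
  have "0 < height (take k x)" if "0 < k" "k < length x" for k
  proof -
    obtain j where j: "k = Suc j" using \<open>0 < k\<close> gr0_implies_Suc by blast
    have "c + 1 \<le> c + 1 + height (take j y)"
      by (rule height_take_ge[of "c + 1" y "c + 1" j]) (use xi y that j in \<open>auto simp: x_def\<close>)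
    then show ?thesis using j by (simp add: x_def)
  qed
  then have mov: "movable u (a @ replicate N False) x b"
    using i y wu by (auto simp: movable_def subpath_def x_def)
  define v' where "v' = a @ replicate (N - i) False @ x @ replicate i False @ b"
  have sl: "slide u N i v'"
    unfolding slide_def using mov i v'_def by (intro exI[of _ a] exI[of _ x] exI[of _ b]) (auto simp: a_def)
  have a: "area 0 a = al" "height a - int (N - i) = c + int i"
    using w2(2,3) al(2) i by (simp_all add: a_def area_append al' of_nat_diff)
  have "area 0 v' = al @ area (c + int i) x @ area (c + int i + height x - int i) b"
    using a(2) by (simp add: v'_def area_append a(1))
  also have "area (c + int i) x = map (\<lambda>x. x + int i) (c # xi)"
    unfolding area_shift x_def by (simp add: y(3))
  also have "c + int i + height x - int i = c"
    by (simp add: x_def y(2))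
  finally have "area 0 v' = area 0 v" by (simp add: hv y(4))
  moreover have "height v' = height v"
    using hz wu i by (simp add: v'_def of_nat_diff)
  ultimately have "v' = v" by (rule area_inject)
  then show ?thesis using sl by simp
qed

text \<open>The first index where \<open>h\<close> and \<open>h'\<close> differ is
  \<open>length al\<close>; the two values there give \<open>c\<close> and \<open>i\<close>, and
  \<open>last al\<close> then gives \<open>N\<close>.\<close>

lemma raise_unique:
  assumes "raise h N i h' al c xi be" "raise h N' i' h' al' c' xi' be'"
  shows "N = N' \<and> i = i'"
proof -
  have first_diff: "length al = (LEAST k. h ! k \<noteq> h' ! k) \<and> al = take (length al) h \<and>
      h ! length al = c \<and> h' ! length al = c + int i"
    if "raise h N i h' al c xi be" for N i al c xi be
  proof -
    have h: "h = al @ (c # xi) @ be" "h' = al @ map (\<lambda>x. x + int i) (c # xi) @ be" "1 \<le> i"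
      using that unfolding raise_def by blast+
    have "(LEAST k. h ! k \<noteq> h' ! k) = length al"
    proof (rule Least_equality)
      show "h ! length al \<noteq> h' ! length al" using h(3) by (simp add: h(1,2))
      show "length al \<le> k" if "h ! k \<noteq> h' ! k" for k
      proof (rule ccontr)
        assume "\<not> length al \<le> k"
        then have "h ! k = al ! k" "h' ! k = al ! k" by (simp_all add: h(1,2) nth_append)
        then show False using that by simp
      qed
    qed
    then show ?thesis by (simp add: h(1,2))
  qed
  note 1 = first_diff[OF assms(1)] and 2 = first_diff[OF assms(2)]
  have l: "length al = length al'" using 1 2 by simp
  then have "al = al'" using 1 2 by metis
  moreover have "c = c'" "int i = int i'" using 1 2 l by auto
  moreover have "int N = last al + 1 - c" "int N' = last al' + 1 - c'"
    using assms unfolding raise_def by blast+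
  ultimately show ?thesis by simp
qed

section \<open>Edges are covers\<close>

definition pad :: "int list \<Rightarrow> nat \<Rightarrow> int" where
  "pad h k = (if k < length h then h ! k else 0)"

text \<open>In terms of plane trees, \<open>descends h j k\<close> says that the \<open>k\<close>-th node in preorder is a
  descendant of the \<open>j\<close>-th one.\<close>

definition descends :: "(nat \<Rightarrow> int) \<Rightarrow> nat \<Rightarrow> nat \<Rightarrow> bool" where
  "descends h j k \<longleftrightarrow> j < k \<and> (\<forall>l. j < l \<and> l \<le> k \<longrightarrow> h j < h l)"

text \<open>This is \<open>raise\<close> on functions: the block occupies the indices from
  \<open>p\<close> to \<open>q - 1\<close>, and \<open>h (p - 1) + 1 - h p\<close> is the number of
  letters 0 before the subpath.\<close>

definition lift_at :: "nat \<Rightarrow> (nat \<Rightarrow> int) \<Rightarrow> nat \<Rightarrow> nat \<Rightarrow> nat \<Rightarrow> (nat \<Rightarrow> int) \<Rightarrow> bool" where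
  "lift_at n h p q i h' \<longleftrightarrow> 0 < p \<and> p < q \<and> q \<le> n \<and> h q = h p \<and> (\<forall>k. p < k \<and> k < q \<longrightarrow> h p < h k) \<and>
     1 \<le> i \<and> int i \<le> h (p - 1) + 1 - h p \<and> h' = (\<lambda>k. if p \<le> k \<and> k < q then h k + int i else h k)"

lemma raise_imp_lift_at:
  assumes "raise h N i h' al c xi be"
  shows "lift_at (length h) (pad h) (length al) (length al + Suc (length xi)) i (pad h')"
proof -
  have h: "h = al @ (c # xi) @ be" "h' = al @ map (\<lambda>x. x + int i) (c # xi) @ be"
    and al0: "al \<noteq> []" "int N = last al + 1 - c" and i: "1 \<le> i" "i \<le> N"
    and xi: "\<forall>x\<in>set xi. c < x" and c: "c = hd (be @ [0])"
    using assms unfolding raise_def by blast+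
  obtain al' l where al: "al = al' @ [l]" using al0 by (metis append_butlast_last_id)
  have at_be: "pad h (length al + Suc (length xi)) = c"
    using c by (cases be) (simp_all add: h(1) pad_def nth_append)
  have above: "c < pad h k" if "length al < k" "k < length al + Suc (length xi)" for k
  proof -
    define j where "j = k - Suc (length al)"
    have "k = Suc (length al + j)" "j < length xi" using that by (auto simp: j_def)
    then show ?thesis using xi by (simp add: h(1) pad_def nth_append)
  qed
  have h': "pad h' k = (if length al \<le> k \<and> k < length al + Suc (length xi) then pad h k + int i else pad h k)" for k
  proof (cases "k < length al")
    case False
    then obtain j where j: "k = length al + j" by (metis le_iff_add linorder_not_less)
    show ?thesis
      by (cases j) (auto simp: h j pad_def nth_append)
  qed (simp add: h pad_def nth_append)
  have at_al: "pad h (length al) = c" "pad h (length al - 1) = last al"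
    by (simp_all add: h(1) pad_def al nth_append)
  have len: "length al + Suc (length xi) \<le> length h" by (simp add: h(1))
  have "int i \<le> last al + 1 - c" using i al0(2) by linarith
  moreover have "pad h' = (\<lambda>k. if length al \<le> k \<and> k < length al + Suc (length xi) then pad h k + int i else pad h k)"
    using h' by blast
  ultimately show ?thesis
    unfolding lift_at_def at_be at_al using al0(1) len above i(1) by simp
qed

lemma lift_at_mono: "lift_at n h p q i h' \<Longrightarrow> h k \<le> h' k"
  by (auto simp: lift_at_def)

text \<open>If \<open>j\<close> lies in the block, all its descendants do, because
  \<open>h q = h p \<le> h j\<close>, and they move along with \<open>j\<close>. Otherwise the value
  at \<open>j\<close> stays and the others do not decrease.\<close>

lemma descends_lift_at:
  assumes "lift_at n h p q i h'" "descends h j k"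
  shows "descends h' j k"
proof (cases "p \<le> j \<and> j < q")
  case True
  have pq: "h q = h p" "\<forall>k. p < k \<and> k < q \<longrightarrow> h p < h k"
    and h': "h' = (\<lambda>k. if p \<le> k \<and> k < q then h k + int i else h k)"
    using assms(1) by (auto simp: lift_at_def)
  have "h p \<le> h j" using True pq by (cases "j = p") (auto intro: less_imp_le)
  moreover have "h j < h q" if "q \<le> k" using assms(2) that True by (simp add: descends_def)
  ultimately have "k < q" using pq(1) by force
  then show ?thesis using True assms(2) by (auto simp: descends_def h')
next
  case False
  then have "h' j = h j" using assms(1) by (auto simp: lift_at_def)
  then show ?thesis using assms(2) lift_at_mono[OF assms(1)]
    by (fastforce simp: descends_def intro: less_le_trans)
qed

text \<open>\<open>j\<close> is the previous sibling of \<open>p\<close>, of which \<open>p\<close>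
  becomes a descendant. It is the last earlier index with value at most \<open>h p\<close>; steps up
  by at most one, or \<open>1 \<le> i\<close> if \<open>j = p - 1\<close>, force equality.\<close>

lemma new_descendant:
  assumes "lift_at n h p q i h'" "h 0 = 0" "\<And>k. 0 \<le> h k" "\<And>k. k < n \<Longrightarrow> h (Suc k) \<le> h k + 1"
  obtains j where "j < p" "descends h' j p" "h j = h p" "\<forall>l. j < l \<and> l < p \<longrightarrow> h p < h l"
proof -
  have L: "0 < p" "p < q" "q \<le> n" "1 \<le> i"
    and h': "h' = (\<lambda>k. if p \<le> k \<and> k < q then h k + int i else h k)"
    using assms(1) by (auto simp: lift_at_def)
  define j where "j = Max {j. j < p \<and> h j \<le> h p}"
  have "finite {j. j < p \<and> h j \<le> h p}" "{j. j < p \<and> h j \<le> h p} \<noteq> {}"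
    using L assms(2) assms(3)[of p] by auto
  from Max_in[OF this] Max_ge[OF this(1)] have j: "j < p" "h j \<le> h p"
    and max: "\<And>l. l < p \<Longrightarrow> h l \<le> h p \<Longrightarrow> l \<le> j" by (auto simp: j_def)
  have gt: "\<forall>l. j < l \<and> l < p \<longrightarrow> h p < h l" using max by (meson linorder_not_less)
  have "h p \<le> h j"
  proof (cases "Suc j = p")
    case True
    then show ?thesis using assms(1) by (auto simp: lift_at_def)
  next
    case False
    then have "h p < h (Suc j)" using gt j(1) by simp
    then show ?thesis using assms(4)[of j] j L by linarith
  qed
  then have eq: "h j = h p" using j by simp
  moreover have "descends h' j p"
    unfolding descends_def h' using j L eq gt by auto
  ultimately show ?thesis using that j gt by blast
qed

text \<open>The descent from \<open>j\<close> to \<open>p'\<close> created in \<open>z\<close>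
  persists in \<open>v\<close>. Since \<open>h j = h p'\<close>, the block of \<open>v\<close>
  contains \<open>p'\<close> but not \<open>j\<close>. It cannot start strictly between them, where
  the values exceed \<open>h p'\<close>, so it starts at \<open>p'\<close>; and \<open>p\<close>
  determines \<open>q\<close>.\<close>

lemma lift_at_first_step:
  assumes ud: "lift_at n h p q i v" and uz: "lift_at n h p' q' i' z"
    and h: "h 0 = 0" "\<And>k. 0 \<le> h k" "\<And>k. k < n \<Longrightarrow> h (Suc k) \<le> h k + 1"
    and zv: "\<And>j k. descends z j k \<Longrightarrow> descends v j k"
  shows "p' = p \<and> q' = q"
proof -
  obtain j where j: "j < p'" "descends z j p'" "h j = h p'" "\<forall>l. j < l \<and> l < p' \<longrightarrow> h p' < h l"
    using new_descendant[OF uz h] by blast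
  have U: "p < q" "h q = h p" "\<forall>k. p < k \<and> k < q \<longrightarrow> h p < h k"
    and v: "v = (\<lambda>k. if p \<le> k \<and> k < q then h k + int i else h k)"
    using ud by (auto simp: lift_at_def)
  have Z: "p' < q'" "h q' = h p'" "\<forall>k. p' < k \<and> k < q' \<longrightarrow> h p' < h k"
    using uz by (auto simp: lift_at_def)
  have "v j < v p'" using zv[OF j(2)] j(1) by (simp add: descends_def)
  then have 1: "p \<le> p'" "p' < q" "j < p \<or> q \<le> j" using j(1,3) by (auto simp: v split: if_splits)
  then have "j < p" using j(1) by auto
  have "h p \<le> h p'" using U(3) 1(1,2) by (cases "p = p'") (auto intro: less_imp_le)
  then have p: "p = p'" using 1 j(4) \<open>j < p\<close> by (meson le_neq_implies_less linorder_not_less)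
  have "\<not> q < q'" using U(1,2) Z(3) p by force
  moreover have "\<not> q' < q" using Z(1,2) U(3) p by force
  ultimately have "q = q'" by simp
  then show ?thesis using p by simp
qed

text \<open>After a partial slide, the moved subpath is followed by the letter \<open>0\<close>, so it is no longer
  movable, and no other slide stays below the full one.\<close>

lemma lift_at_no_second_step:
  assumes uv: "lift_at n h p q i v" and uz: "lift_at n h p q i' z" and zy: "lift_at n z p2 q2 i2 y"
    and z: "z 0 = 0" "\<And>k. 0 \<le> z k" "\<And>k. k < n \<Longrightarrow> z (Suc k) \<le> z k + 1"
    and yv: "\<And>j k. descends y j k \<Longrightarrow> descends v j k"
  shows False
proof -
  obtain j where j: "j < p2" "descends y j p2" "z j = z p2" "\<forall>l. j < l \<and> l < p2 \<longrightarrow> z p2 < z l"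
    using new_descendant[OF zy z] by blast
  have U: "p < q" "h q = h p" "\<forall>k. p < k \<and> k < q \<longrightarrow> h p < h k"
    and v: "v = (\<lambda>k. if p \<le> k \<and> k < q then h k + int i else h k)"
    using uv by (auto simp: lift_at_def)
  have z': "z = (\<lambda>k. if p \<le> k \<and> k < q then h k + int i' else h k)" "1 \<le> i'"
    using uz by (auto simp: lift_at_def)
  have Y: "p2 < q2" "z q2 = z p2" "\<forall>k. p2 < k \<and> k < q2 \<longrightarrow> z p2 < z k"
    using zy by (auto simp: lift_at_def)
  have vj: "v j < v p2" using yv[OF j(2)] j(1) by (simp add: descends_def)
  \<comment> \<open>Otherwise \<open>q\<close>, where the value is still \<open>h p\<close> and so
    below \<open>z j\<close>, would lie after \<open>j\<close> and not after \<open>p2\<close>,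
    against the choice of \<open>j\<close>.\<close>
  have "p2 < q" if "p \<le> j" "j < q"
  proof (rule ccontr)
    assume "\<not> p2 < q"
    then have "z p2 \<le> z q" using j(4) that by (cases "q = p2") (auto intro: less_imp_le)
    moreover have "z q = h p" "h p \<le> h j" "h j < z j"
      using U that z' by (cases "j = p"; auto intro: less_imp_le)+
    ultimately show False using j(3) by simp
  qed
  then have 1: "p \<le> p2" "p2 < q" "j < p \<or> q \<le> j" using vj j(1,3) by (auto simp: v z'(1) split: if_splits)
  then have "j < p" using j(1) by auto
  have "z p \<le> z p2" using U(3) 1(1,2) z' by (cases "p = p2") (auto intro: less_imp_le)
  then have p: "p = p2" using 1 j(4) \<open>j < p\<close> by (meson le_neq_implies_less linorder_not_less)
  \<comment> \<open>The first raise leaves a strictly smaller value at \<open>q\<close>: the block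
    starting at \<open>p\<close> no longer returns to its first value, so no \<open>q2\<close> is
    admissible.\<close>
  have zq: "z q < z p" and zb: "\<forall>k. p < k \<and> k < q \<longrightarrow> z p < z k" using U z' by auto
  have "\<not> q < q2" using Y(3) zq U(1) p by force
  moreover have "\<not> q2 < q" using Y(1,2) zb p by force
  moreover have "q2 \<noteq> q" using Y(2) zq p by force
  ultimately show False by simp
qed


section \<open>Paths in the dexter graph\<close>

lemma dyck_pad:
  assumes "u \<in> dyck_paths n"
  shows "pad (area 0 u) 0 = 0" "0 \<le> pad (area 0 u) k"
    "k < n \<Longrightarrow> pad (area 0 u) (Suc k) \<le> pad (area 0 u) k + 1"
proof -
  have s: "area_seq 0 (area 0 u)" using area_seq_area[OF assms] .
  have len: "length (area 0 u) = n" using assms by (simp add: length_area dyck_paths_iff)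
  show pos: "0 \<le> pad (area 0 u) k" for k using s by (auto simp: pad_def area_seq_def)
  show "pad (area 0 u) 0 = 0" using s by (cases "area 0 u") (auto simp: pad_def area_seq_def)
  show "pad (area 0 u) (Suc k) \<le> pad (area 0 u) k + 1" if "k < n"
  proof (cases "Suc k < n")
    case True
    then show ?thesis using s len by (auto simp: pad_def area_seq_def successively_conv_nth)
  next
    case False
    then show ?thesis using pos[of k] len by (simp add: pad_def)
  qed
qed

lemma pad_area_inject:
  assumes "u \<in> dyck_paths n" "v \<in> dyck_paths n" "pad (area 0 u) = pad (area 0 v)"
  shows "u = v"
proof (rule area_inject)
  have "length (area 0 u) = n" "length (area 0 v) = n"
    using assms(1,2) by (simp_all add: length_area dyck_paths_iff)
  moreover from this have "area 0 u ! k = area 0 v ! k" if "k < n" for k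
    using fun_cong[OF assms(3), of k] that by (simp add: pad_def)
  ultimately show "area 0 u = area 0 v" by (intro nth_equalityI) auto
  show "height u = height v" using assms(1,2) by (simp add: dyck_paths_iff)
qed

lemma dexter_edge_lift_at:
  assumes "dexter_edge n u v"
  obtains p q i where "lift_at n (pad (area 0 u)) p q i (pad (area 0 v))"
proof -
  obtain N i where uv: "u \<in> dyck_paths n" "slide u N i v" using assms by (auto simp: dexter_edge_def)
  then have "length (area 0 u) = n" by (simp add: length_area dyck_paths_iff)
  then show ?thesis using slide_imp_raise[OF uv] raise_imp_lift_at that by metis
qed

lemma dexter_path_mono:
  assumes "(dexter_edge n)\<^sup>*\<^sup>* u v"
  shows "pad (area 0 u) k \<le> pad (area 0 v) k"
    and "descends (pad (area 0 u)) j k \<Longrightarrow> descends (pad (area 0 v)) j k"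
  using assms
proof (induction rule: rtranclp_induct)
  case (step v w)
  obtain p q i where l: "lift_at n (pad (area 0 v)) p q i (pad (area 0 w))"
    using dexter_edge_lift_at step(2) by blast
  case 1
  then show ?case using step(3) lift_at_mono[OF l] order.trans by blast
  case 2
  then show ?case using step(4) descends_lift_at[OF l] by blast
qed auto

lemma dexter_path_antisym:
  assumes "u \<in> dyck_paths n" "v \<in> dyck_paths n" "(dexter_edge n)\<^sup>*\<^sup>* u v" "(dexter_edge n)\<^sup>*\<^sup>* v u"
  shows "u = v"
  using assms by (intro pad_area_inject) (auto intro!: ext order.antisym dexter_path_mono(1))

lemma dexter_edge_neq: "dexter_edge n u v \<Longrightarrow> u \<noteq> v"
proof
  assume e: "dexter_edge n u v" and eq: "u = v"
  obtain p q i where l: "lift_at n (pad (area 0 u)) p q i (pad (area 0 v))"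
    using dexter_edge_lift_at e by blast
  have "pad (area 0 v) p \<noteq> pad (area 0 u) p" using l by (auto simp: lift_at_def)
  then show False using eq by simp
qed

lemma dexter_path_first_edge:
  assumes "(dexter_edge n)\<^sup>*\<^sup>* u v" "u \<noteq> v"
  shows "\<exists>z. dexter_edge n u z \<and> (dexter_edge n)\<^sup>*\<^sup>* z v"
  using assms by (cases rule: converse_rtranclpE) auto

text \<open>Since descendant pairs survive along the path from \<open>z\<close> to \<open>v\<close>,
  the edge to \<open>z\<close> moves the same block as the edge to \<open>v\<close>. A further edge
  on the way to \<open>v\<close> is then impossible.\<close>

lemma dexter_edge_no_detour:
  assumes uv: "dexter_edge n u v" and uz: "dexter_edge n u z" and zv: "(dexter_edge n)\<^sup>*\<^sup>* z v"
  shows "z = v"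
proof (rule ccontr)
  assume "z \<noteq> v"
  then obtain y where zy: "dexter_edge n z y" and yv: "(dexter_edge n)\<^sup>*\<^sup>* y v"
    using dexter_path_first_edge[OF zv] by blast
  have D: "u \<in> dyck_paths n" "z \<in> dyck_paths n" using uv uz by (auto simp: dexter_edge_def)
  obtain p q i where l: "lift_at n (pad (area 0 u)) p q i (pad (area 0 v))"
    using dexter_edge_lift_at uv by blast
  obtain p1 q1 i1 where l1: "lift_at n (pad (area 0 u)) p1 q1 i1 (pad (area 0 z))"
    using dexter_edge_lift_at uz by blast
  obtain p2 q2 i2 where l2: "lift_at n (pad (area 0 z)) p2 q2 i2 (pad (area 0 y))"
    using dexter_edge_lift_at zy by blast
  have "p1 = p \<and> q1 = q"
    by (rule lift_at_first_step[OF l l1 dyck_pad[OF D(1)] dexter_path_mono(2)[OF zv]])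
  then have "lift_at n (pad (area 0 u)) p q i1 (pad (area 0 z))" using l1 by simp
  from lift_at_no_second_step[OF l this l2 dyck_pad[OF D(2)] dexter_path_mono(2)[OF yv]]
  show False .
qed

text \<open>A path realising a cover consists of its first edge. Conversely, an element strictly
  between \<open>u\<close> and \<open>v\<close> lies on a path whose first edge already ends at
  \<open>v\<close>, contradicting antisymmetry.\<close>

lemma hasse_edge_iff_dexter_edge: "hasse_edge n u v \<longleftrightarrow> dexter_edge n u v"
proof
  assume h: "hasse_edge n u v"
  then have D: "u \<in> dyck_paths n" "v \<in> dyck_paths n" and p: "(dexter_edge n)\<^sup>*\<^sup>* u v" "u \<noteq> v"
    by (auto simp: hasse_edge_def dexter_less_def dexter_le_def)
  obtain z where z: "dexter_edge n u z" "(dexter_edge n)\<^sup>*\<^sup>* z v" using dexter_path_first_edge[OF p] by blast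
  have "z = v"
  proof (rule ccontr)
    assume "z \<noteq> v"
    then have "dexter_less n u z" "dexter_less n z v"
      using z D dexter_edge_neq[OF z(1)] r_into_rtranclp[of "dexter_edge n", OF z(1)]
      by (auto simp: dexter_less_def dexter_le_def dexter_edge_def[of n u z])
    then show False using h by (auto simp: hasse_edge_def)
  qed
  then show "dexter_edge n u v" using z by simp
next
  assume e: "dexter_edge n u v"
  have D: "u \<in> dyck_paths n" "v \<in> dyck_paths n" using e by (auto simp: dexter_edge_def)
  have "dexter_less n u v" using e D dexter_edge_neq[OF e] by (auto simp: dexter_less_def dexter_le_def)
  moreover have False if "dexter_less n u z" "dexter_less n z v" for z
  proof -
    have z: "z \<in> dyck_paths n" "(dexter_edge n)\<^sup>*\<^sup>* u z" "u \<noteq> z" "(dexter_edge n)\<^sup>*\<^sup>* z v" "z \<noteq> v"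
      using that by (auto simp: dexter_less_def dexter_le_def)
    obtain y where y: "dexter_edge n u y" "(dexter_edge n)\<^sup>*\<^sup>* y z"
      using dexter_path_first_edge[OF z(2,3)] by blast
    then have "y = v" using dexter_edge_no_detour[OF e y(1)] z(4) by (meson rtranclp_trans)
    then show False using dexter_path_antisym[OF z(1) D(2) z(4)] y(2) z(5) by simp
  qed
  ultimately show "hasse_edge n u v" by (auto simp: hasse_edge_def)
qed

section \<open>Counting incoming edges\<close>

text \<open>A raise ending in \<open>h'\<close> is determined by the index at which the raised block starts, which can
  be any index whose next weakly smaller value is strictly smaller. The predicate \<open>P\<close> selects
  a colour from the value before the block and the first value of the block.\<close>

definition raises :: "(int \<Rightarrow> int \<Rightarrow> bool) \<Rightarrow> int list \<Rightarrow> int list \<Rightarrow> bool" where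
  "raises P h h' \<longleftrightarrow> (\<exists>N i al c xi be. raise h N i h' al c xi be \<and> P (last al) (c + int i))"

fun incoming :: "(int \<Rightarrow> int \<Rightarrow> bool) \<Rightarrow> int \<Rightarrow> int \<Rightarrow> int list \<Rightarrow> nat" where
  "incoming P a e [] = 0"
| "incoming P a e (c # r) =
     of_bool (hd (dropWhile (\<lambda>x. c < x) r @ [e]) < c \<and> P a c) + incoming P c e r"

text \<open>A full slide puts the subpath right behind a letter 1, hence its first entry is one
  above the preceding entry.\<close>

lemma raise_full_iff: "raise h N i h' al c xi be \<Longrightarrow> i = N \<longleftrightarrow> c + int i = last al + 1"
  unfolding raise_def by linarith

lemma red_edge_iff_raises:
  "red_edge n u v \<longleftrightarrow> u \<in> dyck_paths n \<and> v \<in> dyck_paths n \<and>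
     raises (\<lambda>x y. y = x + 1) (area 0 u) (area 0 v)"
proof -
  have "(\<exists>N. slide u N N v) \<longleftrightarrow> raises (\<lambda>x y. y = x + 1) (area 0 u) (area 0 v)"
    if "u \<in> dyck_paths n" "v \<in> dyck_paths n"
    unfolding raises_def
    using slide_imp_raise[OF that(1)] raise_imp_slide[OF that] raise_full_iff by metis
  moreover have "dexter_edge n u v" if "u \<in> dyck_paths n" "v \<in> dyck_paths n" "slide u N N v" for N
    using that by (auto simp: dexter_edge_def)
  ultimately show ?thesis
    unfolding red_edge_def hasse_edge_iff_dexter_edge by (auto simp: dexter_edge_def)
qed

text \<open>By \<open>raise_unique\<close> the endpoints determine \<open>i\<close> and
  \<open>N\<close>, so not being red means that the only slide is partial.\<close>

lemma blue_edge_iff_raises: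
  "blue_edge n u v \<longleftrightarrow> u \<in> dyck_paths n \<and> v \<in> dyck_paths n \<and>
     raises (\<lambda>x y. y \<noteq> x + 1) (area 0 u) (area 0 v)"
proof -
  have "(\<exists>N i. slide u N i v) \<and> \<not> raises (\<lambda>x y. y = x + 1) (area 0 u) (area 0 v) \<longleftrightarrow>
      raises (\<lambda>x y. y \<noteq> x + 1) (area 0 u) (area 0 v)"
    if "u \<in> dyck_paths n" "v \<in> dyck_paths n"
    unfolding raises_def
    using slide_imp_raise[OF that(1)] raise_imp_slide[OF that] raise_full_iff raise_unique by metis
  then show ?thesis
    unfolding blue_edge_def red_edge_iff_raises hasse_edge_iff_dexter_edge
    by (auto simp: dexter_edge_def)
qed

text \<open>The block moves rigidly, and lowering it keeps the steps at both ends at most one: on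
  the right, \<open>be\<close> is empty or starts with \<open>c\<close>, and no entry of the lowered
  block is below \<open>c\<close>.\<close>

lemma raise_area_seq:
  assumes "area_seq 0 h'" "raise h N i h' al c xi be"
  shows "area_seq 0 h" "length h = length h'"
proof -
  have h: "h = al @ (c # xi) @ be" and h': "h' = al @ map (\<lambda>x. x + int i) (c # xi) @ be"
    and al: "al \<noteq> []" "int N = last al + 1 - c" and i: "1 \<le> i" "i \<le> N"
    and xi: "\<forall>x\<in>set xi. c < x" and c: "c = hd (be @ [0])"
    using assms(2) unfolding raise_def by blast+
  have pos: "\<forall>x\<in>set h'. 0 \<le> x" and hd: "hd h' = 0" and s: "successively (\<lambda>x y. y \<le> x + 1) h'"
    using assms(1) al by (auto simp: area_seq_def h')
  have c0: "0 \<le> c" using pos c by (cases be) (auto simp: h')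
  have 1: "successively (\<lambda>x y. y \<le> x + 1) al" "successively (\<lambda>x y. y \<le> x + 1) (map (\<lambda>x. x + int i) (c # xi))"
    "successively (\<lambda>x y. y \<le> x + 1) be"
    using s unfolding h' successively_append_iff by blast+
  have "successively (\<lambda>x y. y \<le> x + 1) (c # xi)"
    using 1(2) unfolding successively_map by simp
  moreover have "be = [] \<or> hd be \<le> last (c # xi) + 1"
    using c bspec[OF xi last_in_set] by (cases "xi = []"; cases be) auto
  moreover have "c \<le> last al + 1" using al i by linarith
  ultimately have "successively (\<lambda>x y. y \<le> x + 1) h"
    unfolding h successively_append_iff using 1 by auto
  moreover have "\<forall>x\<in>set h. 0 \<le> x" using pos xi c0 by (force simp: h h')
  ultimately show "area_seq 0 h" using hd al by (simp add: area_seq_def h h')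
  show "length h = length h'" by (simp add: h h')
qed

lemma area_image_dyck_paths: "area 0 ` dyck_paths n = {h. area_seq 0 h \<and> length h = n}"
proof -
  have "h \<in> area 0 ` dyck_paths n" if h: "area_seq 0 h" "length h = n" for h
  proof -
    obtain t where t: "tree_area 0 t = h" using tree_area_surj[OF h(1)] by blast
    then have "area 0 (word t) = h" by (simp add: area_word)
    moreover from this have "nodes t = n" using h by (metis length_area count_list_word)
    ultimately show ?thesis using word_in_dyck_paths by blast
  qed
  then show ?thesis using area_seq_area by (auto simp: length_area dyck_paths_iff)
qed

section \<open>Sources of the raises reaching a given sequence\<close>

lemma card_raises:
  assumes "v \<in> dyck_paths n"
  shows "card {u \<in> dyck_paths n. raises P (area 0 u) (area 0 v)} = card {h. raises P h (area 0 v)}"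
proof (rule bij_betw_same_card[of "area 0"], unfold bij_betw_def, intro conjI)
  show "inj_on (area 0) {u \<in> dyck_paths n. raises P (area 0 u) (area 0 v)}"
    by (intro inj_onI area_inject[of 0]) (auto simp: dyck_paths_iff)
  have "h \<in> area 0 ` dyck_paths n" if "raises P h (area 0 v)" for h
    unfolding area_image_dyck_paths
    using that raise_area_seq area_seq_area[OF assms] assms
    by (fastforce simp: raises_def length_area dyck_paths_iff)
  then show "area 0 ` {u \<in> dyck_paths n. raises P (area 0 u) (area 0 v)} = {h. raises P h (area 0 v)}"
    by blast
qed

text \<open>\<open>pre\<close> is the part scanned already, kept for the induction on
  \<open>rest\<close>. The bound on \<open>i\<close> is supplied later by the step condition on the
  target.\<close>

definition raise_sources :: "(int \<Rightarrow> int \<Rightarrow> bool) \<Rightarrow> int list \<Rightarrow> int list \<Rightarrow> int list set" where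
  "raise_sources P pre rest = {h. \<exists>al c xi be i. h = pre @ al @ (c # xi) @ be \<and>
     rest = al @ map (\<lambda>x. x + int i) (c # xi) @ be \<and> 1 \<le> i \<and> (\<forall>x\<in>set xi. c < x) \<and>
     c = hd (be @ [0]) \<and> P (last (pre @ al)) (c + int i)}"

lemma takeWhile_dropWhile_append:
  assumes "\<forall>x\<in>set ys. Q x" "zs = [] \<or> \<not> Q (hd zs)"
  shows "takeWhile Q (ys @ zs) = ys" "dropWhile Q (ys @ zs) = zs"
  using assms by (induction ys) (cases zs; auto)+

lemma card_raise_sources:
  "pre \<noteq> [] \<Longrightarrow> finite (raise_sources P pre rest) \<and>
     card (raise_sources P pre rest) = incoming P (last pre) 0 rest"
proof (induction rest arbitrary: pre)
  case Nil
  then show ?case by (simp add: raise_sources_def)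
next
  case (Cons d r)
  define tw dw where "tw = takeWhile (\<lambda>x. d < x) r" and "dw = dropWhile (\<lambda>x. d < x) r"
  have r: "r = tw @ dw" by (simp add: tw_def dw_def)
  define e where "e = hd (dw @ [0])"
  define S where "S = {h. \<exists>c xi be i. h = pre @ (c # xi) @ be \<and>
     d # r = map (\<lambda>x. x + int i) (c # xi) @ be \<and> 1 \<le> i \<and> (\<forall>x\<in>set xi. c < x) \<and>
     c = hd (be @ [0]) \<and> P (last pre) (c + int i)}"
  \<comment> \<open>The only candidate: the block is \<open>d\<close> with the run of larger entries
    after it, lowered so that it starts at \<open>e\<close>, the value following it.\<close>
  define h0 where "h0 = pre @ (e # map (\<lambda>x. x - (d - e)) tw) @ dw"
  have S: "S = (if e < d \<and> P (last pre) d then {h0} else {})"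
  proof -
    have "e < d \<and> P (last pre) d \<and> h = h0" if hS: "h \<in> S" for h
    proof -
      obtain c xi be i where h: "h = pre @ (c # xi) @ be" and d: "d = c + int i"
        and r': "r = map (\<lambda>x. x + int i) xi @ be" and i: "1 \<le> i" and xi: "\<forall>x\<in>set xi. c < x"
        and c: "c = hd (be @ [0])" and P: "P (last pre) (c + int i)"
        using hS unfolding S_def by auto
      have 1: "\<forall>x\<in>set (map (\<lambda>x. x + int i) xi). d < x" using xi d by auto
      have 2: "be = [] \<or> \<not> d < hd be" using c d i by (cases be) auto
      have tw: "tw = map (\<lambda>x. x + int i) xi" and dw: "dw = be"
        unfolding tw_def dw_def r' by (rule takeWhile_dropWhile_append[OF 1 2])+
      have e: "e = c" unfolding e_def dw using c by simp
      have "map (\<lambda>x. x - (d - e)) tw = xi" by (simp add: tw d e comp_def)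
      then have "h = h0" by (simp add: h h0_def e dw)
      moreover have "e < d" using d e i by linarith
      ultimately show ?thesis using P d by simp
    qed
    moreover have "h0 \<in> S" if "e < d" "P (last pre) d"
    proof -
      have "d # r = map (\<lambda>x. x + int (nat (d - e))) (e # map (\<lambda>x. x - (d - e)) tw) @ dw"
        using that(1) by (simp add: r comp_def)
      moreover have "\<forall>x\<in>set (map (\<lambda>x. x - (d - e)) tw). e < x"
        by (auto simp: tw_def dest: set_takeWhileD)
      moreover have "1 \<le> nat (d - e)" "P (last pre) (e + int (nat (d - e)))" using that by auto
      ultimately show ?thesis unfolding S_def h0_def using e_def by blast
    qed
    ultimately show ?thesis by auto
  qed
  have split: "raise_sources P pre (d # r) = S \<union> raise_sources P (pre @ [d]) r"
  proof (intro equalityI subsetI)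
    fix h assume "h \<in> raise_sources P pre (d # r)"
    then obtain al c xi be i where *: "h = pre @ al @ (c # xi) @ be"
      "d # r = al @ map (\<lambda>x. x + int i) (c # xi) @ be" "1 \<le> i" "\<forall>x\<in>set xi. c < x"
      "c = hd (be @ [0])" "P (last (pre @ al)) (c + int i)"
      unfolding raise_sources_def by blast
    show "h \<in> S \<union> raise_sources P (pre @ [d]) r"
    proof (cases al)
      case Nil
      have "h \<in> S" unfolding S_def
        by (rule CollectI, intro exI[of _ c] exI[of _ xi] exI[of _ be] exI[of _ i] conjI)
          (use * Nil in simp_all)
      then show ?thesis by simp
    next
      case (Cons a al')
      then have "h = (pre @ [d]) @ al' @ (c # xi) @ be" "r = al' @ map (\<lambda>x. x + int i) (c # xi) @ be"
        "P (last ((pre @ [d]) @ al')) (c + int i)" using *(1,2,6) by auto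
      then have "h \<in> raise_sources P (pre @ [d]) r"
        unfolding raise_sources_def using *(3-5) by blast
      then show ?thesis by simp
    qed
  next
    fix h assume "h \<in> S \<union> raise_sources P (pre @ [d]) r"
    then show "h \<in> raise_sources P pre (d # r)"
    proof
      assume "h \<in> S"
      then obtain c xi be i where *: "h = pre @ [] @ (c # xi) @ be"
        "d # r = [] @ map (\<lambda>x. x + int i) (c # xi) @ be" "1 \<le> i" "\<forall>x\<in>set xi. c < x"
        "c = hd (be @ [0])" "P (last (pre @ [])) (c + int i)"
        unfolding S_def append_Nil append_Nil2 by blast
      then show ?thesis unfolding raise_sources_def by blast
    next
      assume "h \<in> raise_sources P (pre @ [d]) r"
      then obtain al c xi be i where *: "h = (pre @ [d]) @ al @ (c # xi) @ be"
        "r = al @ map (\<lambda>x. x + int i) (c # xi) @ be" "1 \<le> i" "\<forall>x\<in>set xi. c < x"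
        "c = hd (be @ [0])" "P (last ((pre @ [d]) @ al)) (c + int i)"
        unfolding raise_sources_def by blast
      then have "h = pre @ (d # al) @ (c # xi) @ be" "d # r = (d # al) @ map (\<lambda>x. x + int i) (c # xi) @ be"
        "P (last (pre @ (d # al))) (c + int i)" by simp_all
      then show ?thesis unfolding raise_sources_def using *(3-5) by blast
    qed
  qed
  have disj: "S \<inter> raise_sources P (pre @ [d]) r = {}"
  proof -
    have "h ! length pre = d" if "h \<in> raise_sources P (pre @ [d]) r" for h
      using that by (auto simp: raise_sources_def)
    moreover have "h ! length pre \<noteq> d" if "h \<in> S" for h
      using that by (auto simp: S h0_def split: if_splits)
    ultimately show ?thesis by blast
  qed
  have "finite S" "card S = of_bool (e < d \<and> P (last pre) d)" by (auto simp: S)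
  moreover have "finite (raise_sources P (pre @ [d]) r) \<and>
      card (raise_sources P (pre @ [d]) r) = incoming P d 0 r"
    using Cons.IH[of "pre @ [d]"] by simp
  ultimately show ?case
    unfolding split by (simp add: card_Un_disjoint[OF _ _ disj] e_def dw_def)
qed

lemma card_raises_eq_incoming:
  assumes "area_seq 0 h'"
  shows "card {h. raises P h h'} = incoming P a 0 h'"
proof (cases h')
  case Nil
  then show ?thesis by (simp add: raises_def raise_def)
next
  case (Cons z r)
  then have z: "z = 0" and pos: "\<forall>x\<in>set r. 0 \<le> x" and s: "successively (\<lambda>x y. y \<le> x + 1) h'"
    using assms by (auto simp: area_seq_def)
  have "{h. raises P h h'} = raise_sources P [0] r"
  proof (intro equalityI subsetI)
    fix h assume "h \<in> {h. raises P h h'}"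
    then obtain N i al c xi be where *: "raise h N i h' al c xi be" "P (last al) (c + int i)"
      by (auto simp: raises_def)
    have h: "h = al @ (c # xi) @ be" "h' = al @ map (\<lambda>x. x + int i) (c # xi) @ be" "al \<noteq> []"
      and c: "1 \<le> i" "\<forall>x\<in>set xi. c < x" "c = hd (be @ [0])"
      using *(1) unfolding raise_def by blast+
    obtain al' where al: "al = 0 # al'" using h Cons z by (cases al) auto
    have "h = [0] @ al' @ (c # xi) @ be" "r = al' @ map (\<lambda>x. x + int i) (c # xi) @ be"
      "P (last ([0] @ al')) (c + int i)" using h Cons al *(2) by auto
    then show "h \<in> raise_sources P [0] r" unfolding raise_sources_def using c by blast
  next
    fix h assume "h \<in> raise_sources P [0] r"
    then obtain al c xi be i where *: "h = [0] @ al @ (c # xi) @ be"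
      "r = al @ map (\<lambda>x. x + int i) (c # xi) @ be" "1 \<le> i" "\<forall>x\<in>set xi. c < x"
      "c = hd (be @ [0])" "P (last ([0] @ al)) (c + int i)"
      unfolding raise_sources_def by blast
    have "h' = (0 # al) @ map (\<lambda>x. x + int i) (c # xi) @ be" using * Cons z by simp
    \<comment> \<open>This is \<open>i \<le> N\<close>, read off the step of \<open>h'\<close> into
      the block.\<close>
    then have "c + int i \<le> last (0 # al) + 1" using s by (simp only: successively_append_iff) auto
    then have "raise h (nat (last (0 # al) + 1 - c)) i h' (0 # al) c xi be"
      unfolding raise_def using * Cons z by auto
    moreover have "P (last (0 # al)) (c + int i)" using *(6) by simp
    ultimately show "h \<in> {h. raises P h h'}" unfolding raises_def by blast
  qed
  \<comment> \<open>The leading \<open>0\<close> has no smaller value after it, so it contributes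
    nothing and \<open>a\<close> is arbitrary.\<close>
  moreover have "\<not> hd (dropWhile (\<lambda>x. 0 < x) r @ [0]) < 0"
  proof -
    have "0 \<le> x" if "x \<in> set (dropWhile (\<lambda>x. 0 < x) r @ [0])" for x
      using that pos by (auto dest: set_dropWhileD)
    from this[OF hd_in_set] show ?thesis by simp
  qed
  ultimately show ?thesis using card_raise_sources[of "[0]" P r] by (simp add: Cons z)
qed

section \<open>Statistics on trees\<close>

text \<open>Applied to the left subtree of a node, it selects by the number of children of that
  node: none, one, or at least two.\<close>

fun link :: "'b \<Rightarrow> 'b \<Rightarrow> 'b \<Rightarrow> dtree \<Rightarrow> 'b" where
  "link x y z Leaf = x"
| "link x y z (Node _ Leaf) = y"
| "link x y z (Node _ (Node _ _)) = z"

fun link_count :: "nat \<Rightarrow> nat \<Rightarrow> dtree \<Rightarrow> nat" where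
  "link_count k l Leaf = 0"
| "link_count k l (Node y z) = link_count k l y + link_count k l z + link 0 k l y"

text \<open>For an entry of \<open>h\<close>, the next weakly smaller value lies in \<open>h\<close>
  or is the head \<open>e'\<close> of \<open>z\<close>, so \<open>e'\<close> acts as closing value
  for \<open>h\<close>.\<close>

lemma incoming_append:
  assumes "\<forall>x\<in>set h. e' \<le> x" "z = e' # z'"
  shows "incoming P a e (h @ z) = incoming P a e' h + incoming P (last (a # h)) e z"
  using assms
proof (induction h arbitrary: a)
  case (Cons c h)
  have "hd (dropWhile (\<lambda>x. c < x) (h @ z) @ [e]) = hd (dropWhile (\<lambda>x. c < x) h @ [e'])"
    using Cons.prems by (induction h) auto
  then show ?case using Cons by simp
qed simp

text \<open>The indices counted by \<open>incoming\<close> are the nodes that are the last child of their parent; the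
  parent, given by its subtree \<open>y\<close>, decides the colour: red if this is its only child.\<close>

lemma incoming_tree_area:
  assumes "\<And>x y. y \<le> x \<Longrightarrow> P x y \<longleftrightarrow> Q" "\<And>x. P x (x + 1) \<longleftrightarrow> R"
  shows "e \<le> c \<Longrightarrow> incoming P a e (tree_area c t) =
    link_count (of_bool R) (of_bool Q) t +
    (if e < c then link 0 (of_bool (P a c)) (of_bool Q) t else 0)"
proof (induction t arbitrary: a e c)
  case (Node y z)
  have "dropWhile (\<lambda>x. c < x) (tree_area (c + 1) y) = []"
    using tree_area_ge[of _ "c + 1" y] by force
  then have dw: "hd (dropWhile (\<lambda>x. c < x) (tree_area (c + 1) y) @ [d]) = d" for d by (simp only: append_Nil list.sel)
  have y: "incoming P c d (tree_area (c + 1) y) =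
      link_count (of_bool R) (of_bool Q) y + link 0 (of_bool R) (of_bool Q) y"
    if "d \<le> c" for d
    using Node.IH(1)[of d "c + 1" c] that assms(2)[of c] by simp
  show ?case
  proof (cases z)
    case Leaf
    then show ?thesis using dw y[OF Node.prems] Node.prems by simp
  next
    case (Node y' z')
    define h where "h = c # tree_area (c + 1) y"
    have ge: "\<forall>x\<in>set h. c \<le> x" using tree_area_ge[of _ "c + 1" y] by (force simp: h_def)
    have "last (a # h) \<in> set h" by (simp add: h_def)
    \<comment> \<open>The root of \<open>z\<close> is not a first child: the value before it is at
      least \<open>c\<close>, which decides \<open>P\<close>.\<close>
    then have l: "P (last (a # h)) c \<longleftrightarrow> Q" using ge assms(1) by blast
    have zc: "tree_area c z = c # tree_area (c + 1) y' @ tree_area c z'" using Node by simp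
    have "incoming P a e (tree_area c (Node y z)) = incoming P a e (h @ tree_area c z)"
      by (simp add: h_def)
    also have "\<dots> = incoming P a c h + incoming P (last (a # h)) e (tree_area c z)"
      by (rule incoming_append[OF ge zc])
    \<comment> \<open>The first root has a later sibling at the same depth \<open>c\<close>, so it
      is not counted itself.\<close>
    also have "incoming P a c h = link_count (of_bool R) (of_bool Q) y + link 0 (of_bool R) (of_bool Q) y"
      using dw y[of c] by (simp add: h_def)
    also have "incoming P (last (a # h)) e (tree_area c z) = link_count (of_bool R) (of_bool Q) z +
        (if e < c then of_bool Q else 0)"
      using Node.IH(2)[OF Node.prems, of "last (a # h)"] l Node by (cases z') auto
    finally show ?thesis using Node by simp
  qed
qed simp

lemma C_red_word:
  assumes "nodes t = n"
  shows "C_red n (word t) = link_count 1 0 t"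
proof -
  have D: "word t \<in> dyck_paths n" using word_in_dyck_paths assms by blast
  have "C_red n (word t) =
      card {u \<in> dyck_paths n. raises (\<lambda>x y. y = x + 1) (area 0 u) (area 0 (word t))}"
    using D by (simp add: C_red_def red_edge_iff_raises)
  also have "\<dots> = incoming (\<lambda>x y. y = x + 1) 0 0 (tree_area 0 t)"
    using card_raises[OF D] card_raises_eq_incoming[OF area_seq_area[OF D], of _ 0] by (simp add: area_word)
  also have "\<dots> = link_count 1 0 t"
    using incoming_tree_area[of "\<lambda>x y. y = x + 1" False True 0 0 0 t] by simp
  finally show ?thesis .
qed

lemma C_blue_word:
  assumes "nodes t = n"
  shows "C_blue n (word t) = link_count 0 1 t"
proof -
  have D: "word t \<in> dyck_paths n" using word_in_dyck_paths assms by blast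
  have "C_blue n (word t) =
      card {u \<in> dyck_paths n. raises (\<lambda>x y. y \<noteq> x + 1) (area 0 u) (area 0 (word t))}"
    using D by (simp add: C_blue_def blue_edge_iff_raises)
  also have "\<dots> = incoming (\<lambda>x y. y \<noteq> x + 1) 0 0 (tree_area 0 t)"
    using card_raises[OF D] card_raises_eq_incoming[OF area_seq_area[OF D], of _ 0] by (simp add: area_word)
  also have "\<dots> = link_count 0 1 t"
    using incoming_tree_area[of "\<lambda>x y. y \<noteq> x + 1" True False 0 0 0 t] by simp
  finally show ?thesis .
qed

section \<open>Generating functions\<close>

fun weight :: "'a::comm_semiring_1 \<Rightarrow> 'a \<Rightarrow> dtree \<Rightarrow> 'a" where
  "weight r s Leaf = 1"
| "weight r s (Node y z) = weight r s y * weight r s z * link 1 r s y"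

lemma power_link_count: "r ^ link_count 1 0 t * s ^ link_count 0 1 t = weight r s t"
proof (induction t)
  case (Node y z)
  have "r ^ link 0 1 0 y * s ^ link 0 0 1 y = link 1 r s y"
    by (cases "(0::nat, 1::nat, 0::nat, y)" rule: link.cases) auto
  then show ?case using Node by (simp add: power_add flip: Node) (simp add: ac_simps)
qed simp

section \<open>Sums over trees of given size\<close>

definition trees :: "nat \<Rightarrow> dtree set" where
  "trees n = {t. nodes t = n}"

lemma trees_0: "trees 0 = {Leaf}"
  by (auto simp: trees_def elim: nodes.elims)

lemma trees_Suc:
  "trees (Suc n) = (\<lambda>(k, y, z). Node y z) ` (SIGMA k:{..n}. trees k \<times> trees (n - k))"
proof (intro equalityI subsetI)
  fix t assume "t \<in> trees (Suc n)"
  then obtain y z where "t = Node y z" "nodes y + nodes z = n"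
    by (cases t) (auto simp: trees_def)
  then show "t \<in> (\<lambda>(k, y, z). Node y z) ` (SIGMA k:{..n}. trees k \<times> trees (n - k))"
    by (intro image_eqI[of _ _ "(nodes y, y, z)"]) (auto simp: trees_def)
qed (auto simp: trees_def)

lemma finite_trees: "finite (trees n)"
proof (induction n rule: less_induct)
  case (less n)
  then show ?case
    by (cases n) (auto simp: trees_0 trees_Suc intro!: finite_imageI finite_SigmaI)
qed

lemma sum_trees_Suc:
  "(\<Sum>t\<in>trees (Suc n). f t) = (\<Sum>k\<le>n. \<Sum>y\<in>trees k. \<Sum>z\<in>trees (n - k). f (Node y z))"
proof -
  have "inj_on (\<lambda>(k, y, z). Node y z) (SIGMA k:{..n}. trees k \<times> trees (n - k))"
    by (auto simp: inj_on_def trees_def)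
  then show ?thesis unfolding trees_Suc
    by (subst sum.reindex)
      (auto simp: sum.Sigma sum.cartesian_product finite_trees comp_def case_prod_unfold intro!: sum.cong)
qed

lemma A_eq_sum_weight: "A n r s = (\<Sum>t\<in>trees n. weight r s t)"
proof -
  have "dyck_paths n = word ` trees n"
    using dyck_path_is_word word_in_dyck_paths by (force simp: trees_def)
  moreover have "inj_on word (trees n)" by (rule inj_onI) (rule word_inject)
  ultimately show ?thesis
    unfolding A_def
    by (auto simp: sum.reindex trees_def C_red_word C_blue_word power_link_count[unfolded One_nat_def] intro!: sum.cong)
qed

lemma A_0: "A 0 r s = 1"
  by (simp add: A_eq_sum_weight trees_0)

definition inner_sum :: "nat \<Rightarrow> 'a::comm_semiring_1 \<Rightarrow> 'a \<Rightarrow> 'a" where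
  "inner_sum n r s = (\<Sum>y\<in>trees n. weight r s y * link 1 r s y)"

lemma A_Suc: "A (Suc n) r s = (\<Sum>k\<le>n. inner_sum k r s * A (n - k) r s)"
  unfolding A_eq_sum_weight sum_trees_Suc inner_sum_def weight.simps sum_product
  by (intro sum.cong refl) (simp add: ac_simps)

text \<open>For \<open>Node y z\<close> as left subtree, the parent has weight \<open>r\<close> if
  \<open>z\<close> is \<open>Leaf\<close> and \<open>s\<close> otherwise. Using \<open>s\<close>
  throughout gives \<open>s * A (Suc n) r s\<close>; the case \<open>z = Leaf\<close> is corrected
  by \<open>r - s\<close>.\<close>

lemma inner_sum_Suc:
  fixes r s :: "'a::comm_ring_1"
  shows "inner_sum (Suc n) r s = s * A (Suc n) r s + (r - s) * inner_sum n r s"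
proof -
  have link: "(\<Sum>z\<in>trees m. weight r s z * link 1 r s (Node y z)) = s * A m r s + (if m = 0 then r - s else 0)" for m y
  proof (cases m)
    case 0
    then show ?thesis by (simp add: trees_0 A_0)
  next
    case (Suc j)
    have "link 1 r s (Node y z) = s" if "z \<in> trees m" for z
      using that Suc by (cases z) (auto simp: trees_def)
    then show ?thesis using Suc by (simp add: A_eq_sum_weight sum_distrib_left mult.commute)
  qed
  have "inner_sum (Suc n) r s = (\<Sum>k\<le>n. \<Sum>y\<in>trees k. weight r s y * link 1 r s y *
      (\<Sum>z\<in>trees (n - k). weight r s z * link 1 r s (Node y z)))"
    by (simp add: inner_sum_def sum_trees_Suc sum_distrib_left ac_simps)
  also have "\<dots> = (\<Sum>k\<le>n. inner_sum k r s * (s * A (n - k) r s + (if n - k = 0 then r - s else 0)))"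
    unfolding link by (simp only: inner_sum_def sum_distrib_right)
  also have "\<dots> = s * A (Suc n) r s + (\<Sum>k\<le>n. if k = n then (r - s) * inner_sum k r s else 0)"
    unfolding A_Suc sum_distrib_left sum.distrib[symmetric]
    by (intro sum.cong) (auto simp: algebra_simps)
  finally show ?thesis by simp
qed

text \<open>With \<open>U\<close> the generating function of nonempty paths and \<open>G\<close> that of the paths \<open>y\<close>
  weighted by their parent in a first factor \<open>1 y 0\<close>, eliminating \<open>G\<close> leaves a quadratic equation
  for \<open>U\<close> in which red edges only occur through \<open>1 + r\<close>.\<close>

lemma fps_A:
  fixes r s :: "'a::comm_ring_1"
  defines "U \<equiv> Abs_fps (\<lambda>n. if n = 0 then 0 else A n r s)"
  shows "U = fps_X * (1 + fps_const (1 + r) * U + fps_const s * (U * U))"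
proof -
  define G where "G = Abs_fps (\<lambda>n. inner_sum n r s)"
  have F: "Abs_fps (\<lambda>n. A n r s) = 1 + U"
    by (rule fps_ext) (simp add: U_def A_0)
  have 1: "U = fps_X * (G * (1 + U))"
  proof (rule fps_ext)
    fix n show "fps_nth U n = fps_nth (fps_X * (G * (1 + U))) n"
    proof (cases n)
      case 0
      then show ?thesis by (simp add: U_def)
    next
      case (Suc m)
      have "fps_nth (G * (1 + U)) m = A (Suc m) r s"
        unfolding F[symmetric] G_def by (simp add: A_Suc fps_mult_nth atLeast0AtMost)
      then show ?thesis using Suc by (simp add: U_def)
    qed
  qed
  have 2: "G = 1 + fps_const s * U + fps_const (r - s) * (fps_X * G)"
  proof (rule fps_ext)
    fix n show "fps_nth G n = fps_nth (1 + fps_const s * U + fps_const (r - s) * (fps_X * G)) n"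
    proof (cases n)
      case 0
      then show ?thesis by (simp add: G_def U_def inner_sum_def trees_0)
    next
      case (Suc m)
      then show ?thesis by (simp add: G_def U_def inner_sum_Suc)
    qed
  qed
  have "U = fps_X * ((1 + U) * G)" using 1 by (simp add: mult.commute)
  \<comment> \<open>After one substitution, the remaining term with \<open>G\<close> is
    \<open>U\<close> itself, so \<open>G\<close> disappears without a division.\<close>
  also have "(1 + U) * G = (1 + U) * (1 + fps_const s * U) + fps_const (r - s) * (fps_X * (G * (1 + U)))"
    by (subst 2) (simp add: algebra_simps)
  also have "fps_X * (G * (1 + U)) = U" using 1 by simp
  also have "(1 + U) * (1 + fps_const s * U) + fps_const (r - s) * U =
      1 + fps_const (1 + r) * U + fps_const s * (U * U)"
    by (simp add: algebra_simps flip: fps_const_add fps_const_sub)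
  finally show ?thesis .
qed

lemma A_recurrence:
  fixes r s :: "'a::comm_ring_1"
  defines "u \<equiv> \<lambda>n. if n = 0 then 0 else A n r s"
  shows "u (Suc n) = of_bool (n = 0) + (1 + r) * u n + s * (\<Sum>i\<le>n. u i * u (n - i))"
proof -
  define U where "U = Abs_fps u"
  have "U = fps_X * (1 + fps_const (1 + r) * U + fps_const s * (U * U))"
    using fps_A[of r s] unfolding U_def u_def by simp
  then have "fps_nth U (Suc n) = fps_nth (1 + fps_const (1 + r) * U + fps_const s * (U * U)) n"
    by (metis diff_Suc_1 fps_X_mult_nth nat.distinct(1))
  moreover have "fps_nth (U * U) n = (\<Sum>i\<le>n. u i * u (n - i))"
    by (simp add: U_def fps_mult_nth atLeast0AtMost)
  ultimately show ?thesis by (simp add: U_def)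
qed

theorem mainTheorem4:
  fixes n :: nat and r b :: "'a::field"
  assumes "n \<ge> 1" and "r \<noteq> 0"
  shows "A n r (r * b) = r ^ (n - 1) * A n (1 / r) (b / r)"
proof -
  define u where "u = (\<lambda>n. if n = 0 then 0 else A n r (r * b))"
  define v where "v = (\<lambda>n. if n = 0 then 0 else A n (1 / r) (b / r))"
  have u: "u (Suc n) = of_bool (n = 0) + (1 + r) * u n + r * b * (\<Sum>i\<le>n. u i * u (n - i))" for n
    using A_recurrence[where r = r and s = "r * b"] by (simp add: u_def)
  have v: "v (Suc n) = of_bool (n = 0) + (1 + 1 / r) * v n + b / r * (\<Sum>i\<le>n. v i * v (n - i))" for n
    using A_recurrence[where r = "1 / r" and s = "b / r"] by (simp add: v_def)
  \<comment> \<open>The extra factor \<open>r\<close> avoids the exponent \<open>n - 1\<close> and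
    lets the claim start at \<open>n = 0\<close>, where both sides vanish.\<close>
  have "r * u n = r ^ n * v n" for n
  proof (induction n rule: less_induct)
    case (less n)
    show ?case
    proof (cases n)
      case 0
      then show ?thesis by (simp add: u_def v_def)
    next
      case (Suc m)
      have IH: "r * u i = r ^ i * v i" if "i \<le> m" for i using less Suc that by simp
      \<comment> \<open>The factor \<open>r\<close> in front and the one in \<open>r * b\<close> are
        distributed over the two factors \<open>u\<close>, so that the induction hypothesis applies
        to each.\<close>
      have "r * u n = r * of_bool (m = 0) + (1 + r) * (r * u m) + b * (\<Sum>i\<le>m. (r * u i) * (r * u (m - i)))"
        unfolding Suc u by (simp add: algebra_simps sum_distrib_left)
      also have "(\<Sum>i\<le>m. (r * u i) * (r * u (m - i))) = r ^ m * (\<Sum>i\<le>m. v i * v (m - i))"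
        unfolding sum_distrib_left
      proof (rule sum.cong)
        fix i assume "i \<in> {..m}"
        then have "r ^ m = r ^ i * r ^ (m - i)" by (simp flip: power_add)
        then show "(r * u i) * (r * u (m - i)) = r ^ m * (v i * v (m - i))"
          using IH[of i] IH[of "m - i"] \<open>i \<in> {..m}\<close> by (simp add: ac_simps)
      qed simp
      also have "r * u m = r ^ m * v m" using IH by simp
      also have "r * of_bool (m = 0) = r ^ Suc m * of_bool (m = 0)" by (cases m) simp_all
      finally show ?thesis
        unfolding Suc v using assms(2) by (simp add: field_simps)
    qed
  qed
  from this[of n] have "r * A n r (r * b) = r * (r ^ (n - 1) * A n (1 / r) (b / r))"
    using assms(1) by (cases n) (simp_all add: u_def v_def ac_simps)
  then show ?thesis using assms(2) by simp
qed

end
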